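(* Let $r\geq 1$, let $n=(n_1,\dots,n_r)\in\mathbb{N}_0^r$ and let $f\in\ell^2(\mathbb{F}_\infty^r)$ be supported on $E_n\subseteq\mathbb{F}_\infty^r$. Then $$\left\| L_f\right\|\leq (n_1+1)\cdots (n_r+1)\,\|f\|_{\ell^2(\mathbb{F}_\infty^r)},$$ where $L_f$ is the convolution operator on $\ell^2(\mathbb{F}_\infty^r)$ given by $g\mapsto f*g$ and $\|L_f\|$ is its operator norm.
   Context: $\mathbb{N}_0=\{0,1,2,\dots\}$. $\mathbb{F}_\infty$ is the free group on countably many free generators $g_1,g_2,\dots$, and $\mathbb{F}_\infty^r$ is the direct product of $r$ copies of it. For $x\in\mathbb{F}_\infty$, $|x|$ is its reduced word length with respect to the generators and their inverses. For $j\in\mathbb{N}_0$, $E_j=\{x\in\mathbb{F}_\infty:|x|=j\}$, and for $m=(m_1,\dots,m_r)\in\mathbb{N}_0^r$, $E_m=E_{m_1}\times\cdots\times E_{m_r}\subseteq\mathbb{F}_\infty^r$. Convolution is $(f*g)(s)=\sum_{t,u\in\mathbb{F}_\infty^r:\,tu=s}f(t)g(u)$ for $s\in\mathbb{F}_\infty^r$. *)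

theory Defs
  imports "HOL-Analysis.Analysis" "HOL-Algebra.Product_Groups"
begin

section \<open>The free group on countably many generators\<close>

text \<open>
  The letter \<open>(k, True)\<close> is the generator \<open>g\<close> with index \<open>k + 1\<close>, and \<open>(k, False)\<close> is its
  inverse. Elements of the free group are the reduced words; two of them are multiplied by
  concatenating and then cancelling.
\<close>

type_synonym letter = "nat \<times> bool"

definition letter_inv :: "letter \<Rightarrow> letter" where
  "letter_inv a = (fst a, \<not> snd a)"

definition reduced :: "letter list \<Rightarrow> bool" where
  "reduced w \<longleftrightarrow> successively (\<lambda>a b. b \<noteq> letter_inv a) w"

fun cancel_Cons :: "letter \<Rightarrow> letter list \<Rightarrow> letter list" where
  "cancel_Cons a [] = [a]"
| "cancel_Cons a (b # w) = (if b = letter_inv a then w else a # b # w)"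

definition reduce :: "letter list \<Rightarrow> letter list" where
  "reduce w = foldr cancel_Cons w []"

definition free_group :: "letter list monoid" where
  "free_group = \<lparr>carrier = {w. reduced w}, mult = (\<lambda>u v. reduce (u @ v)), one = []\<rparr>"

definition free_sphere :: "nat \<Rightarrow> letter list set" where
  "free_sphere j = {x \<in> carrier free_group. length x = j}"


section \<open>Finite direct powers\<close>

definition free_power :: "nat \<Rightarrow> (nat \<Rightarrow> letter list) monoid" where
  "free_power r = product_group {1..r} (\<lambda>_. free_group)"

definition sphere_prod :: "nat \<Rightarrow> (nat \<Rightarrow> nat) \<Rightarrow> (nat \<Rightarrow> letter list) set" where
  "sphere_prod r m = (\<Pi>\<^sub>E i\<in>{1..r}. free_sphere (m i))"


section \<open>Square-summable functions on a group, convolution, operator norm\<close>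

text \<open>Functions on \<open>A\<close> are represented by functions on the whole type vanishing outside \<open>A\<close>.\<close>

definition ell2 :: "'a set \<Rightarrow> ('a \<Rightarrow> complex) set" where
  "ell2 A = {f. (\<forall>x. x \<notin> A \<longrightarrow> f x = 0) \<and> (\<lambda>x. (cmod (f x))\<^sup>2) summable_on A}"

definition ell2_norm :: "'a set \<Rightarrow> ('a \<Rightarrow> complex) \<Rightarrow> real" where
  "ell2_norm A f = sqrt (\<Sum>\<^sub>\<infinity>x\<in>A. (cmod (f x))\<^sup>2)"

definition convolution ::
  "('a, 'b) monoid_scheme \<Rightarrow> ('a \<Rightarrow> complex) \<Rightarrow> ('a \<Rightarrow> complex) \<Rightarrow> 'a \<Rightarrow> complex" where
  "convolution G f g s =
     (\<Sum>\<^sub>\<infinity>(t, u)\<in>{(t, u). t \<in> carrier G \<and> u \<in> carrier G \<and> t \<otimes>\<^bsub>G\<^esub> u = s}. f t * g u)"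

definition bounded_ell2_operator ::
  "'a set \<Rightarrow> (('a \<Rightarrow> complex) \<Rightarrow> ('a \<Rightarrow> complex)) \<Rightarrow> bool" where
  "bounded_ell2_operator A T \<longleftrightarrow>
     (\<forall>g\<in>ell2 A. T g \<in> ell2 A) \<and>
     (\<forall>g\<in>ell2 A. \<forall>h\<in>ell2 A. T (\<lambda>x. g x + h x) = (\<lambda>x. T g x + T h x)) \<and>
     (\<forall>c. \<forall>g\<in>ell2 A. T (\<lambda>x. c * g x) = (\<lambda>x. c * T g x)) \<and>
     (\<exists>K. \<forall>g\<in>ell2 A. ell2_norm A (T g) \<le> K * ell2_norm A g)"

text \<open>
  The analogue of \<^const>\<open>onorm\<close> for operators on \<^const>\<open>ell2\<close>. As for \<^const>\<open>onorm\<close>, the real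
  supremum is only meaningful for operators satisfying \<^const>\<open>bounded_ell2_operator\<close>.
\<close>

definition ell2_onorm ::
  "'a set \<Rightarrow> (('a \<Rightarrow> complex) \<Rightarrow> ('a \<Rightarrow> complex)) \<Rightarrow> real" where
  "ell2_onorm A T = (SUP g\<in>ell2 A. ell2_norm A (T g) / ell2_norm A g)"


section \<open>The definitions are meaningful\<close>

lemma letter_inv_inv [simp]: "letter_inv (letter_inv a) = a"
  by (simp add: letter_inv_def)

lemma letter_inv_neq [simp]: "letter_inv a \<noteq> a" "a \<noteq> letter_inv a"
  by (auto simp: letter_inv_def prod_eq_iff)

lemma reduced_Nil [simp]: "reduced []"
  by (simp add: reduced_def)

lemma reduced_Cons:
  "reduced (a # w) \<longleftrightarrow> reduced w \<and> (w \<noteq> [] \<longrightarrow> hd w \<noteq> letter_inv a)"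
  by (cases w) (auto simp: reduced_def)

lemma reduced_cancel_Cons: "reduced w \<Longrightarrow> reduced (cancel_Cons a w)"
  by (cases w) (auto simp: reduced_Cons)

lemma cancel_Cons_inv: "reduced w \<Longrightarrow> cancel_Cons a (cancel_Cons (letter_inv a) w) = w"
proof (cases w)
  case (Cons b v)
  moreover assume "reduced w"
  ultimately show ?thesis by (cases v) (auto simp: reduced_Cons)
qed simp

lemma reduced_foldr: "reduced v \<Longrightarrow> reduced (foldr cancel_Cons w v)"
  by (induction w) (auto simp: reduced_cancel_Cons)

lemma reduced_reduce: "reduced (reduce w)"
  by (simp add: reduce_def reduced_foldr)

lemma reduce_id: "reduced w \<Longrightarrow> reduce w = w"
proof (induction w)
  case (Cons a w)
  then show ?case by (cases w) (auto simp: reduced_Cons reduce_def)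
qed (simp add: reduce_def)

lemma foldr_cancel_Cons:
  assumes "reduced v"
  shows "foldr cancel_Cons (cancel_Cons a w) v = cancel_Cons a (foldr cancel_Cons w v)"
proof (cases w)
  case (Cons b u)
  show ?thesis
  proof (cases "b = letter_inv a")
    case True
    then show ?thesis
      using Cons cancel_Cons_inv[OF reduced_foldr[OF assms]] by simp
  qed (simp add: Cons)
qed simp

lemma foldr_reduce:
  assumes "reduced v"
  shows "foldr cancel_Cons (reduce w) v = foldr cancel_Cons w v"
proof (induction w)
  case (Cons a w)
  have "reduce (a # w) = cancel_Cons a (reduce w)"
    by (simp add: reduce_def)
  then show ?case
    using Cons foldr_cancel_Cons[OF assms] by simp
qed (simp add: reduce_def)

lemma reduce_append_left: "reduce (reduce u @ v) = reduce (u @ v)"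
  using foldr_reduce[OF reduced_reduce[of v], of u] by (simp add: reduce_def)

lemma reduce_append_right: "reduce (u @ reduce v) = reduce (u @ v)"
  using reduce_id[OF reduced_reduce[of v]] by (simp add: reduce_def)

lemma reduce_inverse: "reduce (rev (map letter_inv w) @ w) = []"
proof (induction w)
  case (Cons a w)
  have "reduce (rev (map letter_inv (a # w)) @ a # w) =
        foldr cancel_Cons (rev (map letter_inv w))
          (cancel_Cons (letter_inv a) (cancel_Cons a (reduce w)))"
    by (simp add: reduce_def)
  also have "cancel_Cons (letter_inv a) (cancel_Cons a (reduce w)) = reduce w"
    using cancel_Cons_inv[OF reduced_reduce[of w], of "letter_inv a"] by simp
  finally show ?case
    using Cons by (simp add: reduce_def)
qed (simp add: reduce_def)

lemma group_free_group: "group free_group"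
proof (rule groupI)
  fix x assume "x \<in> carrier free_group"
  show "\<exists>y\<in>carrier free_group. y \<otimes>\<^bsub>free_group\<^esub> x = \<one>\<^bsub>free_group\<^esub>"
  proof
    show "reduce (rev (map letter_inv x)) \<otimes>\<^bsub>free_group\<^esub> x = \<one>\<^bsub>free_group\<^esub>"
      by (simp add: free_group_def reduce_append_left reduce_inverse)
  qed (simp add: free_group_def reduced_reduce)
qed (simp_all add: free_group_def reduced_reduce reduce_id
       reduce_append_left reduce_append_right)

lemma group_free_power: "group (free_power r)"
  by (simp add: free_power_def group_free_group)

lemma sphere_prod_subset: "sphere_prod r m \<subseteq> carrier (free_power r)"
  by (auto simp: sphere_prod_def free_sphere_def free_power_def PiE_iff)

text \<open>The series defining the convolution of square-summable functions converges absolutely.\<close>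

lemma convolution_abs_summable:
  assumes G: "group G" and f: "f \<in> ell2 (carrier G)" and g: "g \<in> ell2 (carrier G)"
  shows "(\<lambda>(t, u). norm (f t * g u)) summable_on
           {(t, u). t \<in> carrier G \<and> u \<in> carrier G \<and> t \<otimes>\<^bsub>G\<^esub> u = s}"
    (is "_ summable_on ?P")
proof -
  interpret group G by fact
  have inj: "inj_on fst ?P" "inj_on snd ?P"
    by (auto simp: inj_on_def)
  have "(\<lambda>x. (cmod (f x))\<^sup>2) summable_on fst ` ?P" "(\<lambda>x. (cmod (g x))\<^sup>2) summable_on snd ` ?P"
    using f g by (auto simp: ell2_def intro: summable_on_subset_banach)
  then have "(\<lambda>p. (cmod (f (fst p)))\<^sup>2 + (cmod (g (snd p)))\<^sup>2) summable_on ?P"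
    by (intro summable_on_add) (simp_all add: summable_on_reindex[OF inj(1)]
      summable_on_reindex[OF inj(2)] o_def)
  then have "(\<lambda>p. norm (case p of (t, u) \<Rightarrow> f t * g u)) summable_on ?P"
  proof (rule Infinite_Sum.abs_summable_on_comparison_test')
    fix p
    have "2 * (cmod (f (fst p)) * cmod (g (snd p)))
        \<le> (cmod (f (fst p)))\<^sup>2 + (cmod (g (snd p)))\<^sup>2"
      using sum_squares_bound[of "cmod (f (fst p))" "cmod (g (snd p))"] by simp
    moreover have "0 \<le> cmod (f (fst p)) * cmod (g (snd p))"
      by simp
    ultimately show "norm (case p of (t, u) \<Rightarrow> f t * g u)
        \<le> (cmod (f (fst p)))\<^sup>2 + (cmod (g (snd p)))\<^sup>2"
      unfolding case_prod_beta norm_mult by linarith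
  qed
  then show ?thesis
    by (simp add: case_prod_unfold)
qed

end

theory Submission
  imports Defs
begin

text \<open>
  Let \<open>t\<close> and \<open>u\<close> be reduced words, where \<open>t\<close> has length \<open>n\<close>. If, in \<open>t \<otimes> u\<close>, exactly \<open>j\<close> letters of \<open>t\<close> cancel
  against letters of \<open>u\<close>, then \<open>0 \<le> j \<le> n\<close>, and the product is the word made of the first
  \<open>n - j\<close> letters of \<open>t\<close> followed by \<open>u\<close> without its first \<open>j\<close> letters. In the direct power there
  is such a \<open>j\<close> in each coordinate, which leaves \<open>N = (n\<^sub>1 + 1) \<cdots> (n\<^sub>r + 1)\<close> possible
  cancellation depths. Accordingly \<open>f * g\<close> is a sum of \<open>N\<close> pieces, one for each depth.

  One piece is easy to bound. Cut \<open>s = t \<otimes> u\<close> after \<open>n - j\<close> letters, say \<open>s = a c\<close>. Every pair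
  \<open>(t, u)\<close> of depth \<open>j\<close> with product \<open>s\<close> has a \<open>t\<close> that starts with \<open>a\<close> and a \<open>u\<close> that ends
  with \<open>c\<close>. By the Cauchy--Schwarz inequality, the square of the piece at \<open>s\<close> is at most
  \<open>\<phi>(a) \<psi>(c)\<close>, where \<open>\<phi>(a)\<close> is the mass of \<open>\<bar>f\<bar>\<^sup>2\<close> on the \<open>t\<close> that start with \<open>a\<close>, and
  \<open>\<psi>(c)\<close> is the mass of \<open>\<bar>g\<bar>\<^sup>2\<close> on the \<open>u\<close> that are \<open>c\<close> after removal of \<open>j\<close> letters. Since \<open>s\<close>
  is determined by \<open>(a, c)\<close>, summing over \<open>s\<close> gives at most \<open>\<Sum>\<phi> \<Sum>\<psi> \<le> \<parallel>f\<parallel>\<^sup>2 \<parallel>g\<parallel>\<^sup>2\<close>: each piece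
  has norm at most \<open>\<parallel>f\<parallel> \<parallel>g\<parallel>\<close>, and \<open>f * g\<close> has norm at most \<open>N \<parallel>f\<parallel> \<parallel>g\<parallel>\<close>.

  The argument about the pieces uses only the two cutting maps, so it is carried out in an
  arbitrary group (\<open>convolution_sum_squares_le\<close>); the free group enters through
  \<open>reduce_append_cancellation\<close>.
\<close>

section \<open>Infinite sums\<close>

lemma norm_infsum_mult_squared_le:
  fixes F G :: "'a \<Rightarrow> complex"
  assumes F: "(\<lambda>x. (cmod (F x))\<^sup>2) summable_on A" and G: "(\<lambda>x. (cmod (G x))\<^sup>2) summable_on A"
    and FG: "(\<lambda>x. cmod (F x * G x)) summable_on A"
  shows "(cmod (\<Sum>\<^sub>\<infinity>x\<in>A. F x * G x))\<^sup>2
       \<le> (\<Sum>\<^sub>\<infinity>x\<in>A. (cmod (F x))\<^sup>2) * (\<Sum>\<^sub>\<infinity>x\<in>A. (cmod (G x))\<^sup>2)"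
    (is "_ \<le> ?a * ?b")
proof -
  have "cmod (\<Sum>\<^sub>\<infinity>x\<in>A. F x * G x) \<le> (\<Sum>\<^sub>\<infinity>x\<in>A. cmod (F x * G x))"
    by (rule norm_infsum_bound[OF FG])
  also have "\<dots> \<le> sqrt (?a * ?b)"
  proof (rule infsum_le_finite_sums[OF FG])
    fix X assume X: "finite X" "X \<subseteq> A"
    have "(\<Sum>x\<in>X. cmod (F x * G x))\<^sup>2 \<le> (\<Sum>x\<in>X. (cmod (F x))\<^sup>2) * (\<Sum>x\<in>X. (cmod (G x))\<^sup>2)"
      unfolding norm_mult by (rule Cauchy_Schwarz_ineq_sum)
    also have "\<dots> \<le> ?a * ?b"
      by (intro mult_mono finite_sum_le_infsum F G X infsum_nonneg sum_nonneg) auto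
    finally show "(\<Sum>x\<in>X. cmod (F x * G x)) \<le> sqrt (?a * ?b)"
      by (rule real_le_rsqrt)
  qed
  finally have "(cmod (\<Sum>\<^sub>\<infinity>x\<in>A. F x * G x))\<^sup>2 \<le> (sqrt (?a * ?b))\<^sup>2"
    by (rule power_mono) simp
  also have "\<dots> = ?a * ?b"
    by (simp add: infsum_nonneg)
  finally show ?thesis .
qed

lemma sum_infsum_fibres:
  fixes h :: "'a \<Rightarrow> 'b::banach"
  assumes "finite J" and h: "h summable_on X"
  shows "(\<Sum>j\<in>J. infsum h {x \<in> X. k x = j}) = infsum h {x \<in> X. k x \<in> J}"
proof -
  have "(\<Sum>j\<in>J. infsum h {x \<in> X. k x = j}) = infsum h (\<Union>j\<in>J. {x \<in> X. k x = j})"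
    using assms(1) by (rule sum_infsum) (auto intro: summable_on_subset_banach[OF h])
  also have "(\<Union>j\<in>J. {x \<in> X. k x = j}) = {x \<in> X. k x \<in> J}"
    by auto
  finally show ?thesis .
qed

lemma sum_infsum_fibres_le:
  fixes h :: "'a \<Rightarrow> real"
  assumes "finite J" and h: "h summable_on X" and nonneg: "\<And>x. 0 \<le> h x"
  shows "(\<Sum>j\<in>J. infsum h {x \<in> X. k x = j}) \<le> infsum h X"
  unfolding sum_infsum_fibres[OF assms(1,2)]
  by (rule infsum_mono_neutral) (auto intro: summable_on_subset_banach[OF h] simp: nonneg h)

section \<open>Convolution and factorizations of products\<close>

text \<open>
  This bounds the piece of \<open>f * g\<close> for one cancellation depth. There, \<open>\<alpha>\<close> takes an initial part
  of a word, \<open>\<gamma>\<close> and \<open>\<delta>\<close> remove initial parts of two possibly different lengths, and \<open>Q s\<close>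
  holds the pairs of this depth with product \<open>s\<close>.
\<close>

lemma sum_squared_infsum_fibre_product_le:
  fixes f g :: "'a \<Rightarrow> complex" and \<alpha> :: "'a \<Rightarrow> 'p" and \<gamma> \<delta> :: "'a \<Rightarrow> 'q"
  assumes f: "f \<in> ell2 A" and g: "g \<in> ell2 A"
    and summable: "\<And>s. (\<lambda>p. cmod (f (fst p) * g (snd p))) summable_on Q s"
    and Q: "\<And>s t u. (t, u) \<in> Q s \<Longrightarrow> t \<in> A \<and> u \<in> A \<and> \<alpha> t = \<alpha> s \<and> \<delta> u = \<gamma> s"
    and inj_fst: "\<And>s. inj_on fst (Q s)" and inj_snd: "\<And>s. inj_on snd (Q s)"
    and X: "finite X" and inj: "inj_on (\<lambda>s. (\<alpha> s, \<gamma> s)) X"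
  shows "(\<Sum>s\<in>X. (cmod (\<Sum>\<^sub>\<infinity>p\<in>Q s. f (fst p) * g (snd p)))\<^sup>2)
       \<le> (ell2_norm A f)\<^sup>2 * (ell2_norm A g)\<^sup>2"
proof -
  let ?f = "\<lambda>t. (cmod (f t))\<^sup>2" and ?g = "\<lambda>u. (cmod (g u))\<^sup>2"
  have sf: "?f summable_on A" and sg: "?g summable_on A"
    using f g by (auto simp: ell2_def)
  define \<phi> where "\<phi> a = infsum ?f {t \<in> A. \<alpha> t = a}" for a
  define \<psi> where "\<psi> c = infsum ?g {u \<in> A. \<delta> u = c}" for c
  have nonneg: "0 \<le> \<phi> a" "0 \<le> \<psi> c" for a c
    by (auto simp: \<phi>_def \<psi>_def intro: infsum_nonneg)
  have pointwise: "(cmod (\<Sum>\<^sub>\<infinity>p\<in>Q s. f (fst p) * g (snd p)))\<^sup>2 \<le> \<phi> (\<alpha> s) * \<psi> (\<gamma> s)" for s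
  proof -
    have sub: "fst ` Q s \<subseteq> {t \<in> A. \<alpha> t = \<alpha> s}" "snd ` Q s \<subseteq> {u \<in> A. \<delta> u = \<gamma> s}"
      using Q by force+
    have sf': "?f summable_on fst ` Q s" and sg': "?g summable_on snd ` Q s"
      using sub by (auto intro: summable_on_subset_banach[OF sf] summable_on_subset_banach[OF sg])
    have F: "(\<lambda>p. ?f (fst p)) summable_on Q s" and G: "(\<lambda>p. ?g (snd p)) summable_on Q s"
      using sf' sg' by (simp_all add: summable_on_reindex inj_fst inj_snd o_def)
    have "infsum (\<lambda>p. ?f (fst p)) (Q s) = infsum ?f (fst ` Q s)"
      by (simp add: infsum_reindex inj_fst o_def)
    also have "\<dots> \<le> \<phi> (\<alpha> s)"
      unfolding \<phi>_def
      by (rule infsum_mono_neutral[OF sf' summable_on_subset_banach[OF sf]]) (use sub in auto)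
    finally have f_le: "infsum (\<lambda>p. ?f (fst p)) (Q s) \<le> \<phi> (\<alpha> s)" .
    have "infsum (\<lambda>p. ?g (snd p)) (Q s) = infsum ?g (snd ` Q s)"
      by (simp add: infsum_reindex inj_snd o_def)
    also have "\<dots> \<le> \<psi> (\<gamma> s)"
      unfolding \<psi>_def
      by (rule infsum_mono_neutral[OF sg' summable_on_subset_banach[OF sg]]) (use sub in auto)
    finally have g_le: "infsum (\<lambda>p. ?g (snd p)) (Q s) \<le> \<psi> (\<gamma> s)" .
    have "(cmod (\<Sum>\<^sub>\<infinity>p\<in>Q s. f (fst p) * g (snd p)))\<^sup>2
        \<le> infsum (\<lambda>p. ?f (fst p)) (Q s) * infsum (\<lambda>p. ?g (snd p)) (Q s)"
      by (rule norm_infsum_mult_squared_le[OF F G summable])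
    also have "\<dots> \<le> \<phi> (\<alpha> s) * \<psi> (\<gamma> s)"
      by (intro mult_mono f_le g_le nonneg infsum_nonneg) simp
    finally show ?thesis .
  qed
  have "(\<Sum>s\<in>X. (cmod (\<Sum>\<^sub>\<infinity>p\<in>Q s. f (fst p) * g (snd p)))\<^sup>2) \<le> (\<Sum>s\<in>X. \<phi> (\<alpha> s) * \<psi> (\<gamma> s))"
    by (rule sum_mono) (rule pointwise)
  also have "\<dots> = (\<Sum>(a, c)\<in>(\<lambda>s. (\<alpha> s, \<gamma> s)) ` X. \<phi> a * \<psi> c)"
    by (simp add: sum.reindex[OF inj])
  also have "\<dots> \<le> (\<Sum>(a, c)\<in>\<alpha> ` X \<times> \<gamma> ` X. \<phi> a * \<psi> c)"
    by (rule sum_mono2) (use X nonneg in auto)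
  also have "\<dots> = sum \<phi> (\<alpha> ` X) * sum \<psi> (\<gamma> ` X)"
    by (simp add: sum_product sum.cartesian_product)
  also have "\<dots> \<le> infsum ?f A * infsum ?g A"
    unfolding \<phi>_def \<psi>_def using X sf sg
    by (intro mult_mono sum_infsum_fibres_le sum_nonneg infsum_nonneg) auto
  also have "\<dots> = (ell2_norm A f)\<^sup>2 * (ell2_norm A g)\<^sup>2"
    by (simp add: ell2_norm_def infsum_nonneg)
  finally show ?thesis .
qed

text \<open>
  Adding up the pieces: the square of a sum of \<open>card J\<close> numbers is at most \<open>card J\<close> times the sum
  of their squares, and each of the \<open>card J\<close> sums of squares is bounded by the previous lemma.
\<close>

lemma convolution_sum_squares_le:
  fixes G :: "('a, 'm) monoid_scheme" and f g :: "'a \<Rightarrow> complex"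
    and \<alpha> :: "'j \<Rightarrow> 'a \<Rightarrow> 'p" and \<gamma> \<delta> :: "'j \<Rightarrow> 'a \<Rightarrow> 'q"
  assumes G: "group G" and f: "f \<in> ell2 (carrier G)" and g: "g \<in> ell2 (carrier G)"
    and supp: "\<And>t. t \<notin> E \<Longrightarrow> f t = 0"
    and J: "finite J"
    and cover: "\<And>t u. t \<in> E \<Longrightarrow> t \<in> carrier G \<Longrightarrow> u \<in> carrier G \<Longrightarrow>
      \<exists>j\<in>J. \<alpha> j t = \<alpha> j (t \<otimes>\<^bsub>G\<^esub> u) \<and> \<delta> j u = \<gamma> j (t \<otimes>\<^bsub>G\<^esub> u)"
    and inj: "\<And>j. j \<in> J \<Longrightarrow> inj_on (\<lambda>s. (\<alpha> j s, \<gamma> j s)) (carrier G)"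
    and X: "finite X" "X \<subseteq> carrier G"
  shows "(\<Sum>s\<in>X. (cmod (convolution G f g s))\<^sup>2)
       \<le> (real (card J) * ell2_norm (carrier G) f * ell2_norm (carrier G) g)\<^sup>2"
proof -
  interpret group G by fact
  let ?A = "carrier G" and ?h = "\<lambda>p. f (fst p) * g (snd p)"
  let ?P = "\<lambda>s. {(t, u). t \<in> ?A \<and> u \<in> ?A \<and> t \<otimes>\<^bsub>G\<^esub> u = s}"
  define R where "R s = {(t, u). t \<in> E \<and> t \<in> ?A \<and> u \<in> ?A \<and> t \<otimes>\<^bsub>G\<^esub> u = s}" for s
  \<comment> \<open>Several \<open>j\<close> may fit the same pair; one of them is chosen so that the pieces are disjoint.\<close>
  define \<kappa> where "\<kappa> p = (SOME j. j \<in> J \<and> \<alpha> j (fst p) = \<alpha> j (fst p \<otimes>\<^bsub>G\<^esub> snd p)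
    \<and> \<delta> j (snd p) = \<gamma> j (fst p \<otimes>\<^bsub>G\<^esub> snd p))" for p
  define Q where "Q j s = {p \<in> R s. \<kappa> p = j}" for j s
  have \<kappa>: "\<kappa> (t, u) \<in> J \<and> \<alpha> (\<kappa> (t, u)) t = \<alpha> (\<kappa> (t, u)) s \<and> \<delta> (\<kappa> (t, u)) u = \<gamma> (\<kappa> (t, u)) s"
    if "(t, u) \<in> R s" for t u s
  proof -
    have "\<exists>j. j \<in> J \<and> \<alpha> j (fst (t, u)) = \<alpha> j (fst (t, u) \<otimes>\<^bsub>G\<^esub> snd (t, u))
        \<and> \<delta> j (snd (t, u)) = \<gamma> j (fst (t, u) \<otimes>\<^bsub>G\<^esub> snd (t, u))"
      using cover[of t u] that by (auto simp: R_def)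
    from someI_ex[OF this] show ?thesis
      using that unfolding \<kappa>_def[symmetric] by (auto simp: R_def)
  qed
  have in_E: "t \<in> E" if "f t \<noteq> 0" for t
    using supp that by blast
  have summable_P: "(\<lambda>p. cmod (?h p)) summable_on ?P s" for s
    using convolution_abs_summable[OF G f g, of s] by (simp add: case_prod_unfold)
  have summable_R: "?h summable_on R s" for s
    by (rule abs_summable_summable, rule summable_on_subset_banach[OF summable_P[of s]])
      (auto simp: R_def)
  have summable_Q: "(\<lambda>p. cmod (?h p)) summable_on Q j s" for j s
    by (rule summable_on_subset_banach[OF summable_P[of s]])
      (auto simp: Q_def R_def)
  have split: "convolution G f g s = (\<Sum>j\<in>J. infsum ?h (Q j s))" for s
  proof -
    have "convolution G f g s = infsum ?h (R s)"
      unfolding convolution_def case_prod_unfold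
      by (rule infsum_cong_neutral) (auto simp: R_def intro: in_E)
    also have "R s = {p \<in> R s. \<kappa> p \<in> J}"
      using \<kappa> by auto
    finally show ?thesis
      unfolding Q_def by (simp add: sum_infsum_fibres[OF J summable_R])
  qed
  have piece: "(\<Sum>s\<in>X. (cmod (infsum ?h (Q j s)))\<^sup>2) \<le> (ell2_norm ?A f)\<^sup>2 * (ell2_norm ?A g)\<^sup>2"
    if "j \<in> J" for j
  proof (rule sum_squared_infsum_fibre_product_le[OF f g summable_Q _ _ _ X(1)])
    show "t \<in> ?A \<and> u \<in> ?A \<and> \<alpha> j t = \<alpha> j s \<and> \<delta> j u = \<gamma> j s" if "(t, u) \<in> Q j s" for s t u
      using that \<kappa>[of t u s] by (auto simp: Q_def R_def)
    show "inj_on fst (Q j s)" "inj_on snd (Q j s)" for s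
      by (auto simp: Q_def R_def inj_on_def)
    show "inj_on (\<lambda>s. (\<alpha> j s, \<gamma> j s)) X"
      using inj[OF that] X(2) by (rule inj_on_subset)
  qed
  have "(cmod (convolution G f g s))\<^sup>2 \<le> (\<Sum>j\<in>J. (cmod (infsum ?h (Q j s)))\<^sup>2) * real (card J)"
    for s
  proof -
    have "(cmod (convolution G f g s))\<^sup>2 \<le> (\<Sum>j\<in>J. cmod (infsum ?h (Q j s)))\<^sup>2"
      unfolding split by (intro power_mono norm_sum) simp
    also have "\<dots> \<le> (\<Sum>j\<in>J. (cmod (infsum ?h (Q j s)))\<^sup>2) * real (card J)"
      by (rule sum_squared_le_sum_of_squares)
    finally show ?thesis .
  qed
  then have "(\<Sum>s\<in>X. (cmod (convolution G f g s))\<^sup>2)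
      \<le> (\<Sum>s\<in>X. (\<Sum>j\<in>J. (cmod (infsum ?h (Q j s)))\<^sup>2) * real (card J))"
    by (intro sum_mono)
  also have "\<dots> = (\<Sum>j\<in>J. \<Sum>s\<in>X. (cmod (infsum ?h (Q j s)))\<^sup>2) * real (card J)"
    unfolding sum_distrib_right[symmetric] by (subst sum.swap) (rule refl)
  also have "\<dots> \<le> (\<Sum>j\<in>J. (ell2_norm ?A f)\<^sup>2 * (ell2_norm ?A g)\<^sup>2) * real (card J)"
    by (intro mult_right_mono sum_mono piece) auto
  also have "\<dots> = (real (card J) * ell2_norm ?A f * ell2_norm ?A g)\<^sup>2"
    by (simp add: power2_eq_square algebra_simps)
  finally show ?thesis .
qed

section \<open>Bounds for operators on square-summable functions\<close>

lemma ell2_norm_nonneg: "0 \<le> ell2_norm A f"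
  by (simp add: ell2_norm_def infsum_nonneg)

lemma ell2_finite_sums_leI:
  assumes zero: "\<And>x. x \<notin> A \<Longrightarrow> f x = 0" and B: "0 \<le> B"
    and bound: "\<And>X. finite X \<Longrightarrow> X \<subseteq> A \<Longrightarrow> (\<Sum>x\<in>X. (cmod (f x))\<^sup>2) \<le> B\<^sup>2"
  shows "f \<in> ell2 A" and "ell2_norm A f \<le> B"
proof -
  have summable: "(\<lambda>x. (cmod (f x))\<^sup>2) summable_on A"
    by (rule nonneg_bdd_above_summable_on) (auto intro: bdd_aboveI2 bound)
  then show "f \<in> ell2 A"
    using zero by (simp add: ell2_def)
  have "(\<Sum>\<^sub>\<infinity>x\<in>A. (cmod (f x))\<^sup>2) \<le> B\<^sup>2"
    by (rule infsum_le_finite_sums[OF summable bound])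
  then show "ell2_norm A f \<le> B"
    unfolding ell2_norm_def using B by (rule real_le_lsqrt[rotated])
qed

lemma ell2_onorm_le:
  assumes K: "0 \<le> K" and bound: "\<And>g. g \<in> ell2 A \<Longrightarrow> ell2_norm A (T g) \<le> K * ell2_norm A g"
  shows "ell2_onorm A T \<le> K"
  unfolding ell2_onorm_def
proof (rule cSUP_least)
  have "(\<lambda>_. 0) \<in> ell2 A"
    by (simp add: ell2_def)
  then show "ell2 A \<noteq> {}"
    by blast
  fix g assume "g \<in> ell2 A"
  from bound[OF this] show "ell2_norm A (T g) / ell2_norm A g \<le> K"
    using K ell2_norm_nonneg[of A g] by (cases "ell2_norm A g = 0") (auto simp: divide_le_eq)
qed

lemma bounded_ell2_operator_convolution:
  assumes G: "group G" and f: "f \<in> ell2 (carrier G)"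
    and maps: "\<And>g. g \<in> ell2 (carrier G) \<Longrightarrow> convolution G f g \<in> ell2 (carrier G)"
    and bound: "\<And>g. g \<in> ell2 (carrier G) \<Longrightarrow>
      ell2_norm (carrier G) (convolution G f g) \<le> K * ell2_norm (carrier G) g"
  shows "bounded_ell2_operator (carrier G) (convolution G f)"
proof -
  let ?P = "\<lambda>s. {(t, u). t \<in> carrier G \<and> u \<in> carrier G \<and> t \<otimes>\<^bsub>G\<^esub> u = s}"
  have summable: "(\<lambda>p. f (fst p) * g (snd p)) summable_on ?P s"
    if "g \<in> ell2 (carrier G)" for g s
    by (rule abs_summable_summable)
      (use convolution_abs_summable[OF G f that, of s] in \<open>simp add: case_prod_unfold\<close>)
  have eq: "convolution G f g s = (\<Sum>\<^sub>\<infinity>p\<in>?P s. f (fst p) * g (snd p))" for g s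
    by (simp add: convolution_def case_prod_unfold)
  have "convolution G f (\<lambda>x. g x + h x) = (\<lambda>s. convolution G f g s + convolution G f h s)"
    if "g \<in> ell2 (carrier G)" "h \<in> ell2 (carrier G)" for g h
    unfolding eq distrib_left by (rule ext) (rule infsum_add[OF summable summable]; fact that)
  moreover have "convolution G f (\<lambda>x. c * g x) = (\<lambda>s. c * convolution G f g s)" for c g
    unfolding eq mult.left_commute[of _ c] by (rule ext) (rule infsum_cmult_right')
  ultimately show ?thesis
    unfolding bounded_ell2_operator_def using maps bound by blast
qed

section \<open>Cancellation in the free group\<close>

text \<open>
  Multiply \<open>u\<close> from the left by the letters of \<open>t\<close>, the last one first. As long as all of them
  have cancelled, the next letter can cancel too; the first letter that does not cancel protects
  all later ones, because \<open>t\<close> is reduced.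
\<close>

lemma reduce_append_cancellation:
  assumes "reduced t" "reduced u"
  shows "\<exists>j\<le>length t. reduce (t @ u) = take (length t - j) t @ drop j u"
  using assms(1)
proof (induction t)
  case Nil
  then show ?case
    using assms(2) by (simp add: reduce_id)
next
  case (Cons a t)
  then obtain j where j: "j \<le> length t" "reduce (t @ u) = take (length t - j) t @ drop j u"
    by (auto simp: reduced_Cons)
  have step: "reduce ((a # t) @ u) = cancel_Cons a (take (length t - j) t @ drop j u)"
    using j(2) by (simp add: reduce_def)
  show ?case
  proof (cases "j = length t \<and> drop j u \<noteq> [] \<and> hd (drop j u) = letter_inv a")
    case True
    then obtain w where w: "drop j u = letter_inv a # w"
      by (cases "drop j u") auto
    then have "drop (Suc j) u = w"
      by (metis drop_Suc list.sel(3) tl_drop)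
    then have "reduce ((a # t) @ u) = take (length (a # t) - Suc j) (a # t) @ drop (Suc j) u"
      using step w True by simp
    then show ?thesis
      using j(1) by (intro exI[of _ "Suc j"]) simp
  next
    case False
    have "cancel_Cons a (take (length t - j) t @ drop j u) = a # take (length t - j) t @ drop j u"
    proof (cases "j = length t")
      case True
      then show ?thesis
        using False by (cases "drop j u") auto
    next
      case jt: False
      then show ?thesis
        using Cons.prems j(1) by (cases t) (auto simp: reduced_Cons take_Cons split: nat.split)
    qed
    then have "reduce ((a # t) @ u) = take (length (a # t) - j) (a # t) @ drop j u"
      using step j(1) by (simp add: Suc_diff_le)
    then show ?thesis
      using j(1) by (intro exI[of _ j]) simp
  qed
qed

definition take_coords :: "nat \<Rightarrow> (nat \<Rightarrow> nat) \<Rightarrow> (nat \<Rightarrow> 'a list) \<Rightarrow> nat \<Rightarrow> 'a list" where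
  "take_coords r k x = (\<lambda>i\<in>{1..r}. take (k i) (x i))"

definition drop_coords :: "nat \<Rightarrow> (nat \<Rightarrow> nat) \<Rightarrow> (nat \<Rightarrow> 'a list) \<Rightarrow> nat \<Rightarrow> 'a list" where
  "drop_coords r k x = (\<lambda>i\<in>{1..r}. drop (k i) (x i))"

lemma inj_on_take_drop_coords:
  "inj_on (\<lambda>s. (take_coords r k s, drop_coords r k s)) (carrier (free_power r))"
proof (rule inj_onI)
  fix x y assume x: "x \<in> carrier (free_power r)" and y: "y \<in> carrier (free_power r)"
    and eq: "(take_coords r k x, drop_coords r k x) = (take_coords r k y, drop_coords r k y)"
  show "x = y"
  proof (rule PiE_ext)
    show "x \<in> (\<Pi>\<^sub>E i\<in>{1..r}. carrier free_group)" "y \<in> (\<Pi>\<^sub>E i\<in>{1..r}. carrier free_group)"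
      using x y by (simp_all add: free_power_def)
    fix i assume i: "i \<in> {1..r}"
    have "take_coords r k x i = take_coords r k y i" "drop_coords r k x i = drop_coords r k y i"
      using eq by simp_all
    then have "take (k i) (x i) = take (k i) (y i)" "drop (k i) (x i) = drop (k i) (y i)"
      using i by (simp_all add: take_coords_def drop_coords_def)
    then show "x i = y i"
      by (metis append_take_drop_id)
  qed
qed

text \<open>
  The coordinates cancel independently of each other, so a cancellation depth in the direct power
  is a function \<open>j\<close>. The length of each \<open>t i\<close> is prescribed, so \<open>j\<close> alone determines where
  the product has to be cut, whatever the pair \<open>(t, u)\<close> is.
\<close>

lemma free_power_mult_cancellation:
  assumes t: "t \<in> sphere_prod r n" and u: "u \<in> carrier (free_power r)"
  shows "\<exists>j\<in>(\<Pi>\<^sub>E i\<in>{1..r}. {..n i}).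
      take_coords r (\<lambda>i. n i - j i) t = take_coords r (\<lambda>i. n i - j i) (t \<otimes>\<^bsub>free_power r\<^esub> u) \<and>
      drop_coords r j u = drop_coords r (\<lambda>i. n i - j i) (t \<otimes>\<^bsub>free_power r\<^esub> u)"
proof -
  have "\<exists>j\<le>n i. (t \<otimes>\<^bsub>free_power r\<^esub> u) i = take (n i - j) (t i) @ drop j (u i)"
    if i: "i \<in> {1..r}" for i
  proof -
    have "reduced (t i)" "length (t i) = n i" "reduced (u i)"
      using t u i by (auto simp: sphere_prod_def free_sphere_def free_power_def free_group_def PiE_iff)
    with reduce_append_cancellation[of "t i" "u i"] show ?thesis
      using i by (auto simp: free_power_def free_group_def)
  qed
  then obtain j where j: "\<And>i. i \<in> {1..r} \<Longrightarrow> j i \<le> n i"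
      "\<And>i. i \<in> {1..r} \<Longrightarrow> (t \<otimes>\<^bsub>free_power r\<^esub> u) i = take (n i - j i) (t i) @ drop (j i) (u i)"
    by metis
  have len: "length (t i) = n i" if "i \<in> {1..r}" for i
    using t that by (auto simp: sphere_prod_def free_sphere_def PiE_iff)
  show ?thesis
  proof (rule bexI[of _ "restrict j {1..r}"])
    show "restrict j {1..r} \<in> (\<Pi>\<^sub>E i\<in>{1..r}. {..n i})"
      using j(1) by auto
  qed (auto simp: take_coords_def drop_coords_def fun_eq_iff j(2) len)
qed

section \<open>Haagerup's inequality for powers of the free group\<close>

theorem proposition3p2:
  fixes r :: nat and n :: "nat \<Rightarrow> nat" and f :: "(nat \<Rightarrow> letter list) \<Rightarrow> complex"
  assumes "r \<ge> 1"
    and "f \<in> ell2 (carrier (free_power r))"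
    and "support_on (carrier (free_power r)) f \<subseteq> sphere_prod r n"
  shows "bounded_ell2_operator (carrier (free_power r)) (convolution (free_power r) f)
    \<and> ell2_onorm (carrier (free_power r)) (convolution (free_power r) f)
        \<le> (\<Prod>i=1..r. real (n i + 1)) * ell2_norm (carrier (free_power r)) f"
proof -
  let ?G = "free_power r" and ?A = "carrier (free_power r)"
  let ?J = "\<Pi>\<^sub>E i\<in>{1..r}. {..n i}"
  let ?K = "(\<Prod>i=1..r. real (n i + 1)) * ell2_norm ?A f"
  interpret group ?G
    by (rule group_free_power)
  have card_J: "real (card ?J) = (\<Prod>i=1..r. real (n i + 1))"
    by (simp add: card_PiE)
  have K: "0 \<le> ?K"
    by (intro mult_nonneg_nonneg prod_nonneg ell2_norm_nonneg) simp
  have supp: "f t = 0" if "t \<notin> sphere_prod r n" for t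
    using that assms(2,3) by (auto simp: support_on_def ell2_def)
  have outside: "convolution ?G f g s = 0" if "s \<notin> ?A" for g s
  proof -
    have "{(t, u). t \<in> ?A \<and> u \<in> ?A \<and> t \<otimes>\<^bsub>?G\<^esub> u = s} = {}"
      using that by auto
    then show ?thesis
      unfolding convolution_def by (simp only: infsum_empty)
  qed
  have finite_sums: "(\<Sum>s\<in>X. (cmod (convolution ?G f g s))\<^sup>2) \<le> (?K * ell2_norm ?A g)\<^sup>2"
    if g: "g \<in> ell2 ?A" and X: "finite X" "X \<subseteq> ?A" for g X
    unfolding card_J[symmetric]
  proof (rule convolution_sum_squares_le[OF group_free_power assms(2) g supp _
        free_power_mult_cancellation inj_on_take_drop_coords X])
    show "finite ?J"
      by (simp add: finite_PiE)
  qed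
  have nonneg: "0 \<le> ?K * ell2_norm ?A g" for g
    by (intro mult_nonneg_nonneg K ell2_norm_nonneg)
  have maps: "convolution ?G f g \<in> ell2 ?A"
    and bound: "ell2_norm ?A (convolution ?G f g) \<le> ?K * ell2_norm ?A g" if "g \<in> ell2 ?A" for g
    using ell2_finite_sums_leI[OF outside nonneg finite_sums[OF that]] by blast+
  show ?thesis
    using bounded_ell2_operator_convolution[OF group_free_power assms(2) maps bound]
      ell2_onorm_le[OF K bound] by blast
qed

end
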